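(* Let $\kappa$ be an uncountable cardinal and let $\mathbb{P}$ be a $\sigma$-distributive forcing notion of size $\kappa$. The following are equivalent: (i) There is a tree $\vec{\mathcal{U}}=\langle U_\eta\mid \eta\in[\kappa]^{<\omega}\rangle$ of $\kappa$-complete ultrafilters on $\kappa$ and a projection $\pi\colon \mathbb{T}_{\vec{\mathcal{U}}}\to B(\mathbb{P})$. (ii) For every $p\in\mathbb{P}$, the filter $D_p(\mathbb{P})$ can be extended to a $\kappa$-complete ultrafilter $U_p$ on $\mathbb{P}$.
   Context: Forcing convention: $p\le q$ means $q$ is stronger than $p$; forcing notions are separative with a minimal element. $B(\mathbb{P})$ is the complete Boolean algebra of regular open subsets of $\mathbb{P}$ (into which $\mathbb{P}$ densely embeds). A map $\pi\colon\mathbb{P}\to\mathbb{Q}$ is a projection if it is order preserving, its image is dense in $\mathbb{Q}$, and for all $p\in\mathbb{P}$ and $q\ge\pi(p)$ there is $p'\ge p$ with $\pi(p')\ge q$. $\mathbb{P}$ is $\sigma$-distributive if the intersection of countably many dense open subsets of $\mathbb{P}$ is dense open. For $p\in\mathbb{P}$, $D_p(\mathbb{P})$ is the filter on $\mathbb{P}$ generated by all dense open subsets of $\mathbb{P}$ together with the set $\{q\in\mathbb{P}\mid q\ge p\}$. A tree of ultrafilters is a sequence $\vec{\mathcal{U}}=\langle U_\eta\mid\eta\in[\kappa]^{<\omega}\rangle$ ($[\kappa]^{<\omega}$ = finite increasing sequences of ordinals below $\kappa$) where each $U_\eta$ is an ultrafilter on $\kappa$ concentrating on $\kappa\setminus(\max(\eta)+1)$.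 The tree Prikry forcing $\mathbb{T}_{\vec{\mathcal{U}}}$ consists of pairs $\langle s,T\rangle$ with $s\in[\kappa]^{<\omega}$, $T\subseteq[\kappa]^{<\omega}$, every $t\in T$ end-extends $s$, and for all $t\in T$, $\{\nu<\kappa\mid t^\frown\nu\in T\}\in U_t$. For $T$ and $\eta$, $T_\eta=\{s\mid \eta^\frown s\in T\}$. Order: $\langle s',T'\rangle\le\langle s,T\rangle$ iff $s\in T'$ and $T\subseteq T'_s$ (with the evident indexing convention). *)

theory Defs
  imports
    "HOL-Analysis.Abstract_Topology"
    "HOL-Library.Countable_Set"
    "HOL-Library.Sublist"
begin

unbundle cardinal_syntax

text \<open>
  Orders are written as in the convention where \<open>le p q\<close> means that \<open>q\<close> is the stronger
  condition, so open sets are upward closed.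
\<close>

definition compat_in :: "'p set \<Rightarrow> ('p \<Rightarrow> 'p \<Rightarrow> bool) \<Rightarrow> 'p \<Rightarrow> 'p \<Rightarrow> bool" where
  "compat_in P le p q \<longleftrightarrow> (\<exists>r\<in>P. le p r \<and> le q r)"

definition separative_on :: "'p set \<Rightarrow> ('p \<Rightarrow> 'p \<Rightarrow> bool) \<Rightarrow> bool" where
  "separative_on P le \<longleftrightarrow>
     (\<forall>p\<in>P. \<forall>q\<in>P. \<not> le p q \<longrightarrow> (\<exists>r\<in>P. le q r \<and> \<not> compat_in P le p r))"

definition forcing_notion :: "'p set \<Rightarrow> ('p \<Rightarrow> 'p \<Rightarrow> bool) \<Rightarrow> bool" where
  "forcing_notion P le \<longleftrightarrow>
     reflp_on P le \<and> transp_on P le \<and> separative_on P le \<and> (\<exists>m\<in>P. \<forall>p\<in>P. le m p)"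

definition dense_in :: "'p set \<Rightarrow> ('p \<Rightarrow> 'p \<Rightarrow> bool) \<Rightarrow> 'p set \<Rightarrow> bool" where
  "dense_in P le D \<longleftrightarrow> D \<subseteq> P \<and> (\<forall>p\<in>P. \<exists>d\<in>D. le p d)"

definition open_in :: "'p set \<Rightarrow> ('p \<Rightarrow> 'p \<Rightarrow> bool) \<Rightarrow> 'p set \<Rightarrow> bool" where
  "open_in P le A \<longleftrightarrow> A \<subseteq> P \<and> (\<forall>p\<in>A. \<forall>q\<in>P. le p q \<longrightarrow> q \<in> A)"

definition dense_open_in :: "'p set \<Rightarrow> ('p \<Rightarrow> 'p \<Rightarrow> bool) \<Rightarrow> 'p set \<Rightarrow> bool" where
  "dense_open_in P le D \<longleftrightarrow> dense_in P le D \<and> open_in P le D"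

text \<open>The intersection is relativized to \<open>P\<close> so that the empty family yields \<open>P\<close>.\<close>

definition sigma_distributive :: "'p set \<Rightarrow> ('p \<Rightarrow> 'p \<Rightarrow> bool) \<Rightarrow> bool" where
  "sigma_distributive P le \<longleftrightarrow>
     (\<forall>\<D>. countable \<D> \<and> (\<forall>D\<in>\<D>. dense_open_in P le D) \<longrightarrow> dense_open_in P le (P \<inter> \<Inter>\<D>))"

definition projection ::
  "'p set \<Rightarrow> ('p \<Rightarrow> 'p \<Rightarrow> bool) \<Rightarrow> 'q set \<Rightarrow> ('q \<Rightarrow> 'q \<Rightarrow> bool) \<Rightarrow> ('p \<Rightarrow> 'q) \<Rightarrow> bool" where
  "projection P leP Q leQ \<pi> \<longleftrightarrow>
     \<pi> \<in> P \<rightarrow> Q \<and>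
     (\<forall>p\<in>P. \<forall>p'\<in>P. leP p p' \<longrightarrow> leQ (\<pi> p) (\<pi> p')) \<and>
     dense_in Q leQ (\<pi> ` P) \<and>
     (\<forall>p\<in>P. \<forall>q\<in>Q. leQ (\<pi> p) q \<longrightarrow> (\<exists>p'\<in>P. leP p p' \<and> leQ q (\<pi> p')))"

definition forcing_topology :: "'p set \<Rightarrow> ('p \<Rightarrow> 'p \<Rightarrow> bool) \<Rightarrow> 'p topology" where
  "forcing_topology P le = topology (open_in P le)"

lemma openin_forcing_topology: "openin (forcing_topology P le) = open_in P le"
proof -
  have "istopology (open_in P le)"
    unfolding istopology_def open_in_def by blast
  then show ?thesis
    unfolding forcing_topology_def by (rule topology_inverse')
qed

lemma topspace_forcing_topology: "topspace (forcing_topology P le) = P"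
  unfolding topspace_def openin_forcing_topology open_in_def by blast

text \<open>
  As a forcing notion, \<open>B(P)\<close> consists of the nonzero elements of the Boolean algebra of regular
  open sets; a smaller set is a stronger condition.
\<close>

definition BP :: "'p set \<Rightarrow> ('p \<Rightarrow> 'p \<Rightarrow> bool) \<Rightarrow> 'p set set" where
  "BP P le =
     {A. A \<noteq> {} \<and> forcing_topology P le interior_of (forcing_topology P le closure_of A) = A}"

definition BP_le :: "'p set \<Rightarrow> 'p set \<Rightarrow> bool" where
  "BP_le A B \<longleftrightarrow> B \<subseteq> A"

definition filter_on :: "'a set \<Rightarrow> 'a set set \<Rightarrow> bool" where
  "filter_on A F \<longleftrightarrow>
     F \<subseteq> Pow A \<and> A \<in> F \<and> {} \<notin> F \<and>
     (\<forall>X\<in>F. \<forall>Y\<in>F. X \<inter> Y \<in> F) \<and>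
     (\<forall>X\<in>F. \<forall>Y. X \<subseteq> Y \<and> Y \<subseteq> A \<longrightarrow> Y \<in> F)"

definition ultrafilter_on :: "'a set \<Rightarrow> 'a set set \<Rightarrow> bool" where
  "ultrafilter_on A F \<longleftrightarrow> filter_on A F \<and> (\<forall>X. X \<subseteq> A \<longrightarrow> X \<in> F \<or> A - X \<in> F)"

definition kappa_complete :: "'k rel \<Rightarrow> 'a set set \<Rightarrow> bool" where
  "kappa_complete \<kappa> F \<longleftrightarrow> (\<forall>\<X>. \<X> \<subseteq> F \<and> \<X> \<noteq> {} \<and> |\<X>| <o \<kappa> \<longrightarrow> \<Inter>\<X> \<in> F)"

definition generated_filter :: "'a set \<Rightarrow> 'a set set \<Rightarrow> 'a set set" where
  "generated_filter A S = {X. X \<subseteq> A \<and> (\<exists>G. finite G \<and> G \<subseteq> S \<and> A \<inter> \<Inter>G \<subseteq> X)}"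

definition dense_filter :: "'p set \<Rightarrow> ('p \<Rightarrow> 'p \<Rightarrow> bool) \<Rightarrow> 'p \<Rightarrow> 'p set set" where
  "dense_filter P le p =
     generated_filter P ({D. dense_open_in P le D} \<union> {{q \<in> P. le p q}})"

text \<open>
  A cardinal \<open>\<kappa>\<close> is a cardinal order; the elements of its field play the role of the ordinals
  below \<open>\<kappa>\<close>, and finite increasing sequences are strictly increasing lists over the field.
\<close>

definition fin_seqs :: "'k rel \<Rightarrow> 'k list set" where
  "fin_seqs \<kappa> = {\<eta>. set \<eta> \<subseteq> Field \<kappa> \<and> sorted_wrt (\<lambda>\<alpha> \<beta>. (\<alpha>, \<beta>) \<in> \<kappa> \<and> \<alpha> \<noteq> \<beta>) \<eta>}"

text \<open>
  For nonempty \<open>\<eta>\<close> the maximum is \<open>last \<eta>\<close>, and \<open>aboveS \<kappa> (last \<eta>)\<close> is the set of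
  ordinals below \<open>\<kappa>\<close> that exceed it; for empty \<open>\<eta>\<close> there is no constraint.
\<close>

definition ultrafilter_tree :: "'k rel \<Rightarrow> ('k list \<Rightarrow> 'k set set) \<Rightarrow> bool" where
  "ultrafilter_tree \<kappa> U \<longleftrightarrow>
     (\<forall>\<eta>\<in>fin_seqs \<kappa>. ultrafilter_on (Field \<kappa>) (U \<eta>) \<and>
        (\<eta> \<noteq> [] \<longrightarrow> aboveS \<kappa> (last \<eta>) \<in> U \<eta>))"

text \<open>
  The requirement \<open>s \<in> T\<close> makes the order reflexive and excludes the empty set as \<open>T\<close>.
\<close>

definition tree_prikry ::
  "'k rel \<Rightarrow> ('k list \<Rightarrow> 'k set set) \<Rightarrow> ('k list \<times> 'k list set) set" where
  "tree_prikry \<kappa> U =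
     {(s, T). s \<in> fin_seqs \<kappa> \<and> T \<subseteq> fin_seqs \<kappa> \<and> s \<in> T \<and> (\<forall>t\<in>T. prefix s t) \<and>
        (\<forall>t\<in>T. {\<nu> \<in> Field \<kappa>. t @ [\<nu>] \<in> T} \<in> U t)}"

definition subtree_at :: "'k list set \<Rightarrow> 'k list \<Rightarrow> 'k list set" where
  "subtree_at T \<eta> = {s. \<eta> @ s \<in> T}"

text \<open>
  All members of the tree of a condition end-extend its stem, so the two trees are compared after
  removing the stem \<open>s\<close> of the stronger condition from both of them.
\<close>

definition tree_prikry_le ::
  "'k list \<times> 'k list set \<Rightarrow> 'k list \<times> 'k list set \<Rightarrow> bool" where
  "tree_prikry_le = (\<lambda>(s', T') (s, T). s \<in> T' \<and> subtree_at T s \<subseteq> subtree_at T' s)"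

end

theory Submission
  imports Defs
begin

text \<open>
  Given a projection \<open>\<pi>\<close>, the strong Prikry property says that for every dense open \<open>D\<close> a fixed
  number of further steps from a stem decides an element of \<open>D\<close>; by distributivity this number can
  be chosen independently of \<open>D\<close>, say \<open>n\<close>. The set of \<open>q\<close> which some condition with stem \<open>t\<close>
  projects below is \<open>\<kappa>\<close>-directed of size at most \<open>\<kappa>\<close>, so its cones lie in a \<open>\<kappa>\<close>-complete
  ultrafilter \<open>W t\<close>: if some \<open>U \<eta>\<close> is uniform, push it forward along a sequence of upper bounds of
  initial segments; otherwise all \<open>U \<eta>\<close> are principal and there is a least tree with stem \<open>t\<close>. The
  limit of the \<open>W t\<close> along the \<open>n\<close>-fold iteration of the \<open>U \<eta>\<close> extends the dense filter.

  Conversely, label the nodes of the tree by elements of \<open>P\<close>, each used unboundedly often, and let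
  \<open>U \<eta>\<close> be a copy above \<open>last \<eta>\<close> of the given ultrafilter at the label of \<open>\<eta>\<close>. Each dense open set
  is then met in one step by almost all successors, so the labels along a generic branch generate a
  generic filter for \<open>P\<close>.
\<close>

section \<open>Cardinal orders\<close>

lemma Card_order_linear:
  assumes "Card_order \<kappa>"
  shows "trans \<kappa>" "antisym \<kappa>" "Total \<kappa>" "Refl \<kappa>"
  using card_order_on_well_order_on[OF assms]
  unfolding well_order_on_def linear_order_on_def partial_order_on_def preorder_on_def by auto

lemma countable_card_less:
  assumes "Card_order \<kappa>" "uncountable (Field \<kappa>)" "countable X"
  shows "|X| <o \<kappa>"
proof (rule ccontr)
  assume "\<not> |X| <o \<kappa>"
  then have "\<kappa> \<le>o |X|"
    using assms(1) card_of_Well_order card_order_on_well_order_on not_ordLess_iff_ordLeq by blast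
  then have "|Field \<kappa>| \<le>o |X|"
    using assms(1) card_of_Field_ordIso ordIso_ordLeq_trans by blast
  then obtain f where "inj_on f (Field \<kappa>)" "f ` Field \<kappa> \<subseteq> X"
    using card_of_ordLeq by metis
  then have "countable (f ` Field \<kappa>)"
    using countable_subset[OF _ assms(3)] by blast
  then show False
    using countable_image_inj_on[OF _ \<open>inj_on f (Field \<kappa>)\<close>] assms(2) by blast
qed

text \<open>An infinite cardinal has no largest element, so some \<open>\<beta>\<close> lies
  strictly above \<open>\<alpha>\<close>, and by linearity also above everything that is not above
  \<open>\<alpha>\<close>. Thus the complement of a final segment has size less than
  \<open>\<kappa>\<close>.\<close>

lemma complement_aboveS_subset_underS:
  assumes "Card_order \<kappa>" "uncountable (Field \<kappa>)" "\<alpha> \<in> Field \<kappa>"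
  obtains \<beta> where "\<beta> \<in> Field \<kappa>" "\<alpha> \<in> underS \<kappa> \<beta>" "Field \<kappa> - aboveS \<kappa> \<alpha> \<subseteq> underS \<kappa> \<beta>"
proof -
  have "infinite (Field \<kappa>)"
    using assms(2) countable_finite by blast
  then obtain \<beta> where b: "\<beta> \<in> Field \<kappa>" "\<alpha> \<noteq> \<beta>" "(\<alpha>, \<beta>) \<in> \<kappa>"
    using infinite_Card_order_limit[OF assms(1)] assms(3) by blast
  note L = Card_order_linear[OF assms(1)]
  have "x \<in> underS \<kappa> \<beta>" if "x \<in> Field \<kappa> - aboveS \<kappa> \<alpha>" for x
  proof -
    have "(x, \<alpha>) \<in> \<kappa>"
      using that L(3,4) assms(3) unfolding aboveS_def total_on_def refl_on_def
      by (cases "x = \<alpha>") auto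
    then have "(x, \<beta>) \<in> \<kappa>" "x \<noteq> \<beta>"
      using transD[OF L(1) _ b(3)] antisymD[OF L(2) b(3)] b(2) by blast+
    then show ?thesis
      unfolding underS_def by blast
  qed
  moreover have "\<alpha> \<in> underS \<kappa> \<beta>"
    using b unfolding underS_def by blast
  ultimately show ?thesis
    using that b(1) by blast
qed

text \<open>As \<open>P \<times> Field \<kappa>\<close> has size \<open>\<kappa>\<close>, the first
  coordinate of a bijection onto it has fibres of size \<open>\<kappa>\<close>; a set of this size
  does not fit into a proper initial segment.\<close>

lemma unbounded_fibres:
  assumes "Card_order \<kappa>" "uncountable (Field \<kappa>)" "|P| =o \<kappa>"
  obtains f where "f \<in> Field \<kappa> \<rightarrow> P"
    "\<And>\<alpha> p. \<alpha> \<in> Field \<kappa> \<Longrightarrow> p \<in> P \<Longrightarrow> \<exists>\<nu>\<in>aboveS \<kappa> \<alpha>. f \<nu> = p"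
proof -
  have F: "|Field \<kappa>| =o \<kappa>"
    using assms(1) card_of_Field_ordIso by blast
  have PF: "|P| =o |Field \<kappa>|"
    using assms(3) F ordIso_symmetric ordIso_transitive by blast
  have inf: "infinite (Field \<kappa>)"
    using assms(2) countable_finite by blast
  have "infinite P"
    using PF inf card_of_ordIso_finite by blast
  then have "P \<noteq> {}"
    by auto
  have "|P \<times> Field \<kappa>| =o |Field \<kappa>|"
    using card_of_Times_infinite[OF inf \<open>P \<noteq> {}\<close>] PF ordIso_iff_ordLeq by blast
  then obtain g where g: "bij_betw g (Field \<kappa>) (P \<times> Field \<kappa>)"
    using card_of_ordIso ordIso_symmetric by blast
  show ?thesis
  proof (rule that[of "fst \<circ> g"])
    show "fst \<circ> g \<in> Field \<kappa> \<rightarrow> P"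
      using bij_betwE[OF g] by (auto simp: mem_Times_iff)
  next
    fix \<alpha> p assume \<alpha>: "\<alpha> \<in> Field \<kappa>" and p: "p \<in> P"
    obtain \<beta> where \<beta>: "\<beta> \<in> Field \<kappa>" "Field \<kappa> - aboveS \<kappa> \<alpha> \<subseteq> underS \<kappa> \<beta>"
      using complement_aboveS_subset_underS[OF assms(1,2) \<alpha>] by blast
    define i where "i = (\<lambda>x. inv_into (Field \<kappa>) g (p, x))"
    have i: "i x \<in> Field \<kappa>" "g (i x) = (p, x)" if "x \<in> Field \<kappa>" for x
    proof -
      have "(p, x) \<in> g ` Field \<kappa>"
        using g that p unfolding bij_betw_def by auto
      then show "i x \<in> Field \<kappa>" "g (i x) = (p, x)"
        unfolding i_def by (auto intro: inv_into_into f_inv_into_f)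
    qed
    have "inj_on i (Field \<kappa>)"
      by (rule inj_onI) (metis i(2) snd_conv)
    show "\<exists>\<nu>\<in>aboveS \<kappa> \<alpha>. (fst \<circ> g) \<nu> = p"
    proof (rule ccontr)
      assume "\<not> ?thesis"
      then have "i ` Field \<kappa> \<subseteq> underS \<kappa> \<beta>"
        using i \<beta>(2) by fastforce
      then have "|Field \<kappa>| \<le>o |underS \<kappa> \<beta>|"
        using \<open>inj_on i (Field \<kappa>)\<close> card_of_ordLeq by blast
      moreover have "|underS \<kappa> \<beta>| <o |Field \<kappa>|"
        using card_of_underS[OF assms(1) \<beta>(1)] F ordIso_symmetric ordLess_ordIso_trans by blast
      ultimately show False
        using not_ordLess_ordLeq by blast
    qed
  qed
qed

section \<open>Complete ultrafilters\<close>

definition complete_ultrafilter :: "'k rel \<Rightarrow> 'a set \<Rightarrow> 'a set set \<Rightarrow> bool" where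
  "complete_ultrafilter \<kappa> A V \<longleftrightarrow> ultrafilter_on A V \<and> kappa_complete \<kappa> V"

lemma complete_ultrafilterD:
  assumes "complete_ultrafilter \<kappa> A V"
  shows "X \<in> V \<Longrightarrow> X \<subseteq> A" "A \<in> V" "{} \<notin> V" "X \<in> V \<Longrightarrow> Y \<in> V \<Longrightarrow> X \<inter> Y \<in> V"
    "X \<in> V \<Longrightarrow> X \<subseteq> Y \<Longrightarrow> Y \<subseteq> A \<Longrightarrow> Y \<in> V" "X \<subseteq> A \<Longrightarrow> X \<notin> V \<Longrightarrow> A - X \<in> V"
    "\<X> \<subseteq> V \<Longrightarrow> \<X> \<noteq> {} \<Longrightarrow> |\<X>| <o \<kappa> \<Longrightarrow> \<Inter>\<X> \<in> V"
  using assms unfolding complete_ultrafilter_def ultrafilter_on_def filter_on_def kappa_complete_def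
  by (auto simp only:)

lemma complete_ultrafilter_INT:
  assumes "complete_ultrafilter \<kappa> A V" "I \<noteq> {}" "|I| <o \<kappa>" "\<And>i. i \<in> I \<Longrightarrow> X i \<in> V"
  shows "(\<Inter>i\<in>I. X i) \<in> V"
proof (rule complete_ultrafilterD(7)[OF assms(1)])
  show "|X ` I| <o \<kappa>"
    using card_of_image assms(3) by (rule ordLeq_ordLess_trans)
qed (use assms(2,4) in auto)

lemma complete_ultrafilter_principal:
  assumes "a \<in> A"
  shows "complete_ultrafilter \<kappa> A {X. X \<subseteq> A \<and> a \<in> X}"
  using assms unfolding complete_ultrafilter_def ultrafilter_on_def filter_on_def kappa_complete_def
  by auto

text \<open>The limit of the ultrafilters \<open>W a\<close> along \<open>V\<close>, which is the
  bind operation of the ultrafilter monad.\<close>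

definition ultra_bind :: "'a set \<Rightarrow> 'a set set \<Rightarrow> 'b set \<Rightarrow> ('a \<Rightarrow> 'b set set) \<Rightarrow> 'b set set" where
  "ultra_bind A V B W = {X. X \<subseteq> B \<and> {a \<in> A. X \<in> W a} \<in> V}"

text \<open>Premises about members of the limit hold for \<open>V\<close>-almost all
  \<open>a\<close>. Fewer than \<open>\<kappa>\<close> such index sets have an intersection in
  \<open>V\<close>, and on it the matching property of \<open>W a\<close> applies.\<close>

lemma complete_ultrafilter_bind:
  assumes V: "complete_ultrafilter \<kappa> A V" and W: "\<And>a. a \<in> A \<Longrightarrow> complete_ultrafilter \<kappa> B (W a)"
  shows "complete_ultrafilter \<kappa> B (ultra_bind A V B W)"
proof -
  note VD = complete_ultrafilterD[OF V] and WD = complete_ultrafilterD[OF W]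
  let ?F = "ultra_bind A V B W"
  have 1: "B \<in> ?F"
  proof -
    have "{a \<in> A. B \<in> W a} = A"
      using WD(2) by blast
    then show ?thesis
      using VD(2) unfolding ultra_bind_def by simp
  qed
  have 2: "{} \<notin> ?F"
  proof -
    have eq: "{a \<in> A. {} \<in> W a} = {}"
      using WD(3) by blast
    show ?thesis
      unfolding ultra_bind_def mem_Collect_eq eq using VD(3) by blast
  qed
  have 3: "X \<inter> Y \<in> ?F" if "X \<in> ?F" "Y \<in> ?F" for X Y
  proof -
    have "{a \<in> A. X \<in> W a} \<inter> {a \<in> A. Y \<in> W a} \<in> V"
      using that VD(4) unfolding ultra_bind_def by simp
    then have "{a \<in> A. X \<inter> Y \<in> W a} \<in> V"
      by (rule VD(5)) (use WD(4) in auto)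
    then show ?thesis
      using that unfolding ultra_bind_def by auto
  qed
  have 4: "Y \<in> ?F" if "X \<in> ?F" "X \<subseteq> Y" "Y \<subseteq> B" for X Y
  proof -
    have "{a \<in> A. X \<in> W a} \<in> V"
      using that unfolding ultra_bind_def by simp
    then have "{a \<in> A. Y \<in> W a} \<in> V"
      by (rule VD(5)) (use WD(5) that in auto)
    then show ?thesis
      using that unfolding ultra_bind_def by auto
  qed
  have 5: "B - X \<in> ?F" if "X \<subseteq> B" "X \<notin> ?F" for X
  proof -
    have "A - {a \<in> A. X \<in> W a} \<in> V"
      using that VD(6)[of "{a \<in> A. X \<in> W a}"] unfolding ultra_bind_def by blast
    then have "{a \<in> A. B - X \<in> W a} \<in> V"
      by (rule VD(5)) (use WD(6) that in auto)
    then show ?thesis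
      unfolding ultra_bind_def by auto
  qed
  have 6: "\<Inter>\<X> \<in> ?F" if "\<X> \<subseteq> ?F" "\<X> \<noteq> {}" "|\<X>| <o \<kappa>" for \<X>
  proof -
    have "(\<Inter>X\<in>\<X>. {a \<in> A. X \<in> W a}) \<in> V"
      by (rule complete_ultrafilter_INT[OF V that(2,3)]) (use that(1) in \<open>auto simp: ultra_bind_def\<close>)
    then have "{a \<in> A. \<Inter>\<X> \<in> W a} \<in> V"
    proof (rule VD(5))
      show "(\<Inter>X\<in>\<X>. {a \<in> A. X \<in> W a}) \<subseteq> {a \<in> A. \<Inter>\<X> \<in> W a}"
      proof
        fix a assume a: "a \<in> (\<Inter>X\<in>\<X>. {a \<in> A. X \<in> W a})"
        then have "a \<in> A" "\<X> \<subseteq> W a"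
          using that(2) by auto
        then show "a \<in> {a \<in> A. \<Inter>\<X> \<in> W a}"
          using WD(7) that by blast
      qed
    qed auto
    then show ?thesis
      using that unfolding ultra_bind_def by blast
  qed
  have "?F \<subseteq> Pow B"
    unfolding ultra_bind_def by blast
  then have "filter_on B ?F"
    unfolding filter_on_def using 1 2 3 4 by (intro conjI ballI allI impI) auto
  moreover have "kappa_complete \<kappa> ?F"
    unfolding kappa_complete_def using 6 by (intro allI impI) auto
  ultimately show ?thesis
    unfolding complete_ultrafilter_def ultrafilter_on_def using 5 by auto
qed

text \<open>The pushforward along \<open>f\<close> is the limit of the principal ultrafilters at the
  points \<open>f a\<close>.\<close>

lemma complete_ultrafilter_map:
  assumes "complete_ultrafilter \<kappa> A V" "f \<in> A \<rightarrow> B"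
  shows "complete_ultrafilter \<kappa> B {X. X \<subseteq> B \<and> {a \<in> A. f a \<in> X} \<in> V}"
proof -
  have "complete_ultrafilter \<kappa> B (ultra_bind A V B (\<lambda>a. {X. X \<subseteq> B \<and> f a \<in> X}))"
    using assms by (intro complete_ultrafilter_bind complete_ultrafilter_principal) auto
  moreover have "ultra_bind A V B (\<lambda>a. {X. X \<subseteq> B \<and> f a \<in> X}) =
      {X. X \<subseteq> B \<and> {a \<in> A. f a \<in> X} \<in> V}"
    unfolding ultra_bind_def by (intro Collect_cong conj_cong) auto
  ultimately show ?thesis
    by simp
qed

text \<open>If a final segment is not in \<open>V\<close>, then its complement is, and this lies in
  an initial segment of size less than \<open>\<kappa>\<close>. If no singleton were in
  \<open>V\<close>, completeness would allow removing all these points, leaving the empty set in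
  \<open>V\<close>.\<close>

lemma complete_ultrafilter_uniform_or_principal:
  assumes \<kappa>: "Card_order \<kappa>" "uncountable (Field \<kappa>)" and V: "complete_ultrafilter \<kappa> (Field \<kappa>) V"
  shows "(\<forall>\<alpha>\<in>Field \<kappa>. aboveS \<kappa> \<alpha> \<in> V) \<or> (\<exists>\<nu>\<in>Field \<kappa>. {\<nu>} \<in> V)"
proof (rule ccontr)
  assume neg: "\<not> ?thesis"
  note VD = complete_ultrafilterD[OF V]
  from neg obtain \<alpha> where \<alpha>: "\<alpha> \<in> Field \<kappa>" "aboveS \<kappa> \<alpha> \<notin> V"
    by blast
  obtain \<beta> where \<beta>: "\<beta> \<in> Field \<kappa>" "\<alpha> \<in> underS \<kappa> \<beta>" "Field \<kappa> - aboveS \<kappa> \<alpha> \<subseteq> underS \<kappa> \<beta>"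
    using complement_aboveS_subset_underS[OF \<kappa> \<alpha>(1)] by blast
  have "aboveS \<kappa> \<alpha> \<subseteq> Field \<kappa>"
    unfolding aboveS_def Field_def by blast
  then have 1: "Field \<kappa> - aboveS \<kappa> \<alpha> \<in> V"
    using VD(6) \<alpha>(2) by blast
  have "underS \<kappa> \<beta> \<subseteq> Field \<kappa>"
    unfolding underS_def Field_def by blast
  then have "(\<Inter>x\<in>underS \<kappa> \<beta>. Field \<kappa> - {x}) \<in> V"
    using \<beta> card_of_underS[OF \<kappa>(1) \<beta>(1)] neg VD(6)
    by (intro complete_ultrafilter_INT[OF V]) auto
  then have "(Field \<kappa> - aboveS \<kappa> \<alpha>) \<inter> (\<Inter>x\<in>underS \<kappa> \<beta>. Field \<kappa> - {x}) \<in> V"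
    using 1 VD(4) by blast
  moreover have "(Field \<kappa> - aboveS \<kappa> \<alpha>) \<inter> (\<Inter>x\<in>underS \<kappa> \<beta>. Field \<kappa> - {x}) = {}"
    using \<beta>(3) by blast
  ultimately show False
    using VD(3) by simp
qed

section \<open>Regular open sets\<close>

text \<open>Closure adds the points with an extension in \<open>A\<close>; interior keeps the points
  all of whose extensions are in the set. So regular open means that \<open>A\<close> consists of
  exactly those points above which \<open>A\<close> is dense.\<close>

lemma BP_iff:
  assumes "reflp_on P le" "transp_on P le"
  shows "A \<in> BP P le \<longleftrightarrow> A \<noteq> {} \<and> A \<subseteq> P \<and>
    A = {q \<in> P. \<forall>r\<in>P. le q r \<longrightarrow> (\<exists>r'\<in>A. le r r')}"
proof -
  let ?X = "forcing_topology P le"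
  have refl: "le x x" if "x \<in> P" for x
    using reflp_onD[OF assms(1) that] .
  have trans: "le x z" if "le x y" "le y z" "x \<in> P" "y \<in> P" "z \<in> P" for x y z
    using transp_onD[OF assms(2)] that by blast
  have up: "open_in P le {y \<in> P. le x y}" if "x \<in> P" for x
    using that trans unfolding open_in_def by blast
  have cl: "?X closure_of A = {x \<in> P. \<exists>y\<in>A. le x y}" if "A \<subseteq> P"
  proof
    show "?X closure_of A \<subseteq> {x \<in> P. \<exists>y\<in>A. le x y}"
    proof
      fix x assume "x \<in> ?X closure_of A"
      then have x: "x \<in> P" and *: "\<And>T. x \<in> T \<Longrightarrow> open_in P le T \<Longrightarrow> \<exists>y\<in>A. y \<in> T"
        unfolding closure_of_def topspace_forcing_topology openin_forcing_topology by auto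
      show "x \<in> {x \<in> P. \<exists>y\<in>A. le x y}"
        using *[OF _ up[OF x]] x refl by blast
    qed
    show "{x \<in> P. \<exists>y\<in>A. le x y} \<subseteq> ?X closure_of A"
      using that
      unfolding closure_of_def topspace_forcing_topology openin_forcing_topology open_in_def by blast
  qed
  have int: "?X interior_of C = {q \<in> P. \<forall>r\<in>P. le q r \<longrightarrow> r \<in> C}" if "C \<subseteq> P" for C
  proof
    show "?X interior_of C \<subseteq> {q \<in> P. \<forall>r\<in>P. le q r \<longrightarrow> r \<in> C}"
      unfolding interior_of_def openin_forcing_topology open_in_def by blast
    show "{q \<in> P. \<forall>r\<in>P. le q r \<longrightarrow> r \<in> C} \<subseteq> ?X interior_of C"
      using up refl unfolding interior_of_def openin_forcing_topology by blast
  qed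
  have "A \<subseteq> P" if "?X interior_of (?X closure_of A) = A"
    using that interior_of_subset_topspace topspace_forcing_topology by metis
  moreover have "?X interior_of (?X closure_of A) =
      {q \<in> P. \<forall>r\<in>P. le q r \<longrightarrow> (\<exists>r'\<in>A. le r r')}" if "A \<subseteq> P"
    using int[of "?X closure_of A"] cl[OF that] by auto
  ultimately have "?X interior_of (?X closure_of A) = A \<longleftrightarrow>
      A \<subseteq> P \<and> A = {q \<in> P. \<forall>r\<in>P. le q r \<longrightarrow> (\<exists>r'\<in>A. le r r')}"
    by (cases "A \<subseteq> P") (simp_all only: eq_commute[of A] simp_thms, argo+)
  then show ?thesis
    unfolding BP_def mem_Collect_eq by (rule arg_cong)
qed

section \<open>Cones and the dense embedding into the regular open algebra\<close>

locale forcing =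
  fixes P :: "'p set" and le :: "'p \<Rightarrow> 'p \<Rightarrow> bool"
  assumes forcing: "forcing_notion P le"
begin

lemma reflp: "reflp_on P le" and transp: "transp_on P le"
  using forcing unfolding forcing_notion_def by auto

lemma refl: "x \<in> P \<Longrightarrow> le x x"
  using reflp_onD[OF reflp] .

lemma trans: "le x y \<Longrightarrow> le y z \<Longrightarrow> x \<in> P \<Longrightarrow> y \<in> P \<Longrightarrow> z \<in> P \<Longrightarrow> le x z"
  using transp_onD[OF transp] by blast

lemma nonempty: "P \<noteq> {}"
  using forcing unfolding forcing_notion_def by auto

lemma separative:
  assumes "p \<in> P" "q \<in> P" "\<And>r. r \<in> P \<Longrightarrow> le q r \<Longrightarrow> compat_in P le p r"
  shows "le p q"
  using assms forcing unfolding forcing_notion_def separative_on_def by blast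

definition cone :: "'p \<Rightarrow> 'p set" where
  "cone p = {q \<in> P. le p q}"

lemmas BP_iff' = BP_iff[OF reflp transp]

lemma BP_subset: "A \<in> BP P le \<Longrightarrow> A \<subseteq> P"
  and BP_nonempty: "A \<in> BP P le \<Longrightarrow> A \<noteq> {}"
  using BP_iff' by blast+

lemma BP_up: "A \<in> BP P le \<Longrightarrow> p \<in> A \<Longrightarrow> q \<in> P \<Longrightarrow> le p q \<Longrightarrow> q \<in> A"
proof -
  assume A: "A \<in> BP P le" and p: "p \<in> A" and q: "q \<in> P" "le p q"
  then have eq: "A = {q \<in> P. \<forall>r\<in>P. le q r \<longrightarrow> (\<exists>r'\<in>A. le r r')}" and "p \<in> P"
    using BP_iff' by blast+
  have "\<exists>r'\<in>A. le r r'" if "r \<in> P" "le q r" for r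
  proof -
    have "le p r"
      using trans q that \<open>p \<in> P\<close> by blast
    then show ?thesis
      using p that(1) eq by blast
  qed
  then show "q \<in> A"
    using q(1) by (subst eq) blast
qed

text \<open>If \<open>cone p\<close> is dense above \<open>q\<close>, every extension of
  \<open>q\<close> is compatible with \<open>p\<close>, and separativity yields
  \<open>le p q\<close>. So the embedding into \<open>BP P le\<close> can use cones without
  regularizing them.\<close>

lemma cone_BP:
  assumes "p \<in> P"
  shows "cone p \<in> BP P le"
proof -
  have "q \<in> cone p" if q: "q \<in> P" "\<forall>r\<in>P. le q r \<longrightarrow> (\<exists>r'\<in>cone p. le r r')" for q
  proof -
    have "le p q"
      using q assms by (intro separative) (auto simp: cone_def compat_in_def)
    then show ?thesis
      using q by (simp add: cone_def)
  qed
  moreover have "\<exists>r'\<in>cone p. le r r'" if "q \<in> cone p" "r \<in> P" "le q r" for q r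
    using that assms refl trans unfolding cone_def by blast
  moreover have "cone p \<noteq> {}" "cone p \<subseteq> P"
    using assms refl unfolding cone_def by blast+
  ultimately show ?thesis
    unfolding BP_iff' by blast
qed

end

section \<open>Trees of complete ultrafilters\<close>

lemma fin_seqs_snoc:
  assumes \<kappa>: "Card_order \<kappa>" and "\<eta> \<in> fin_seqs \<kappa>" and "\<nu> \<in> Field \<kappa>"
    and "\<eta> \<noteq> [] \<Longrightarrow> \<nu> \<in> aboveS \<kappa> (last \<eta>)"
  shows "\<eta> @ [\<nu>] \<in> fin_seqs \<kappa>"
proof -
  note L = Card_order_linear[OF \<kappa>]
  let ?R = "\<lambda>\<alpha> \<beta>. (\<alpha>, \<beta>) \<in> \<kappa> \<and> \<alpha> \<noteq> \<beta>"
  have srt: "sorted_wrt ?R \<eta>" and fld: "set \<eta> \<subseteq> Field \<kappa>"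
    using assms(2) unfolding fin_seqs_def by auto
  have "?R x \<nu>" if "x \<in> set \<eta>" for x
  proof -
    have ne: "\<eta> \<noteq> []"
      using that by auto
    then have last: "(last \<eta>, \<nu>) \<in> \<kappa>" "last \<eta> \<noteq> \<nu>"
      using assms(4) unfolding aboveS_def by auto
    have "x = last \<eta> \<or> ?R x (last \<eta>)"
    proof -
      have "\<eta> = butlast \<eta> @ [last \<eta>]"
        using ne by simp
      then have "sorted_wrt ?R (butlast \<eta> @ [last \<eta>])" "x \<in> set (butlast \<eta> @ [last \<eta>])"
        using srt that by simp_all
      then show ?thesis
        by (auto simp: sorted_wrt_append)
    qed
    then show ?thesis
      using last transD[OF L(1) _ last(1)] antisymD[OF L(2) last(1)] by blast
  qed
  then show ?thesis
    using srt fld assms(3) unfolding fin_seqs_def by (auto simp: sorted_wrt_append)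
qed

section \<open>Conditions of the tree Prikry forcing\<close>

locale ultra_tree =
  fixes \<kappa> :: "'k rel" and U :: "'k list \<Rightarrow> 'k set set"
  assumes Card_order: "Card_order \<kappa>" and uncountable: "uncountable (Field \<kappa>)"
    and tree: "ultrafilter_tree \<kappa> U"
    and complete: "\<And>\<eta>. \<eta> \<in> fin_seqs \<kappa> \<Longrightarrow> kappa_complete \<kappa> (U \<eta>)"
begin

abbreviation TP :: "('k list \<times> 'k list set) set" where
  "TP \<equiv> tree_prikry \<kappa> U"

lemma complete_U: "\<eta> \<in> fin_seqs \<kappa> \<Longrightarrow> complete_ultrafilter \<kappa> (Field \<kappa>) (U \<eta>)"
  using tree complete unfolding ultrafilter_tree_def complete_ultrafilter_def by blast

lemmas UD = complete_ultrafilterD[OF complete_U]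

text \<open>Concentration above the maximum makes almost every one-step extension increasing again,
  so arguments about almost all successors may assume it.\<close>

lemma snoc_in_U:
  assumes "\<eta> \<in> fin_seqs \<kappa>"
  shows "{\<nu> \<in> Field \<kappa>. \<eta> @ [\<nu>] \<in> fin_seqs \<kappa>} \<in> U \<eta>"
proof (cases "\<eta> = []")
  case True
  then have "{\<nu> \<in> Field \<kappa>. \<eta> @ [\<nu>] \<in> fin_seqs \<kappa>} = Field \<kappa>"
    unfolding fin_seqs_def by auto
  then show ?thesis
    using UD(2)[OF assms] by simp
next
  case False
  then have "aboveS \<kappa> (last \<eta>) \<in> U \<eta>"
    using tree assms unfolding ultrafilter_tree_def by blast
  then show ?thesis
  proof (rule UD(5)[OF assms])
    show "aboveS \<kappa> (last \<eta>) \<subseteq> {\<nu> \<in> Field \<kappa>. \<eta> @ [\<nu>] \<in> fin_seqs \<kappa>}"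
    proof
      fix \<nu> assume n: "\<nu> \<in> aboveS \<kappa> (last \<eta>)"
      then have "\<nu> \<in> Field \<kappa>"
        unfolding aboveS_def Field_def by blast
      then show "\<nu> \<in> {\<nu> \<in> Field \<kappa>. \<eta> @ [\<nu>] \<in> fin_seqs \<kappa>}"
        using fin_seqs_snoc[OF Card_order assms] n by blast
    qed
  qed auto
qed

lemma TP_I:
  assumes "s \<in> T" "T \<subseteq> fin_seqs \<kappa>" "\<And>t. t \<in> T \<Longrightarrow> prefix s t"
    "\<And>t. t \<in> T \<Longrightarrow> \<exists>X\<in>U t. \<forall>\<nu>\<in>X. t @ [\<nu>] \<in> T"
  shows "(s, T) \<in> TP"
proof -
  have "{\<nu> \<in> Field \<kappa>. t @ [\<nu>] \<in> T} \<in> U t" if t: "t \<in> T" for t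
  proof -
    have tf: "t \<in> fin_seqs \<kappa>"
      using t assms(2) by blast
    obtain X where X: "X \<in> U t" "\<forall>\<nu>\<in>X. t @ [\<nu>] \<in> T"
      using assms(4)[OF t] by blast
    from X(1) show ?thesis
      by (rule UD(5)[OF tf]) (use X UD(1)[OF tf X(1)] in auto)
  qed
  then show ?thesis
    using assms unfolding tree_prikry_def by auto
qed

lemma TP_D:
  assumes "(s, T) \<in> TP"
  shows "s \<in> T" "s \<in> fin_seqs \<kappa>" "T \<subseteq> fin_seqs \<kappa>" "\<And>t. t \<in> T \<Longrightarrow> prefix s t"
    "\<And>t. t \<in> T \<Longrightarrow> {\<nu> \<in> Field \<kappa>. t @ [\<nu>] \<in> T} \<in> U t"
  using assms unfolding tree_prikry_def mem_Collect_eq prod.case by blast+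

text \<open>Every node of \<open>T\<close> end-extends \<open>s\<close>, so comparing the trees
  after removing \<open>s\<close> amounts to comparing them directly.\<close>

lemma TP_le:
  assumes "(s, T) \<in> TP" "(s', T') \<in> TP"
  shows "tree_prikry_le (s', T') (s, T) \<longleftrightarrow> s \<in> T' \<and> T \<subseteq> T'"
proof -
  have "subtree_at T s \<subseteq> subtree_at T' s \<longleftrightarrow> T \<subseteq> T'"
  proof
    assume sub: "subtree_at T s \<subseteq> subtree_at T' s"
    show "T \<subseteq> T'"
    proof
      fix t assume "t \<in> T"
      moreover obtain u where "t = s @ u"
        using TP_D(4)[OF assms(1) \<open>t \<in> T\<close>] by (rule prefixE)
      ultimately show "t \<in> T'"
        using sub unfolding subtree_at_def by blast
    qed
  qed (auto simp: subtree_at_def)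
  then show ?thesis
    unfolding tree_prikry_le_def by simp
qed

lemma full_tree_TP:
  assumes "s \<in> fin_seqs \<kappa>"
  shows "(s, {t \<in> fin_seqs \<kappa>. prefix s t}) \<in> TP"
proof (rule TP_I)
  fix t assume t: "t \<in> {t \<in> fin_seqs \<kappa>. prefix s t}"
  then show "\<exists>X\<in>U t. \<forall>\<nu>\<in>X. t @ [\<nu>] \<in> {t \<in> fin_seqs \<kappa>. prefix s t}"
    by (intro bexI[OF _ snoc_in_U]) auto
qed (use assms in auto)

lemma restrict_TP:
  assumes "(s, T) \<in> TP" "t \<in> T"
  shows "(t, {u \<in> T. prefix t u}) \<in> TP"
proof (rule TP_I)
  fix u assume u: "u \<in> {u \<in> T. prefix t u}"
  then show "\<exists>X\<in>U u. \<forall>\<nu>\<in>X. u @ [\<nu>] \<in> {u \<in> T. prefix t u}"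
    by (intro bexI[OF _ TP_D(5)[OF assms(1), of u]]) auto
qed (use assms TP_D[OF assms(1)] in auto)

text \<open>Completeness is applied separately at each node. This is the
  \<open>\<kappa>\<close>-closure of the direct extension order, in which the stem stays
  fixed.\<close>

lemma INT_TP:
  assumes "I \<noteq> {}" "|I| <o \<kappa>" "\<And>i. i \<in> I \<Longrightarrow> (s, T i) \<in> TP"
  shows "(s, \<Inter>i\<in>I. T i) \<in> TP"
proof (rule TP_I)
  note D = TP_D[OF assms(3)]
  show "s \<in> (\<Inter>i\<in>I. T i)"
    using D(1) by blast
  show sub: "(\<Inter>i\<in>I. T i) \<subseteq> fin_seqs \<kappa>"
    using D(3) assms(1) by blast
  show "prefix s t" if "t \<in> (\<Inter>i\<in>I. T i)" for t
    using D(4) assms(1) that by blast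
  fix t assume t: "t \<in> (\<Inter>i\<in>I. T i)"
  then have "(\<Inter>i\<in>I. {\<nu> \<in> Field \<kappa>. t @ [\<nu>] \<in> T i}) \<in> U t"
    using D(5) sub by (intro complete_ultrafilter_INT[OF complete_U assms(1,2)]) auto
  then show "\<exists>X\<in>U t. \<forall>\<nu>\<in>X. t @ [\<nu>] \<in> (\<Inter>i\<in>I. T i)"
    by (rule bexI[rotated]) auto
qed

section \<open>The strong Prikry property\<close>

text \<open>Largeness for the \<open>n\<close>-fold iteration of the ultrafilters along the tree:
  almost all choices of \<open>n\<close> successive entries lead from \<open>t\<close> into
  \<open>S\<close>.\<close>

primrec reach :: "'k list set \<Rightarrow> nat \<Rightarrow> 'k list \<Rightarrow> bool" where
  "reach S 0 t \<longleftrightarrow> t \<in> S"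
| "reach S (Suc n) t \<longleftrightarrow> {\<nu> \<in> Field \<kappa>. reach S n (t @ [\<nu>])} \<in> U t"

lemma reach_mono:
  assumes "S \<subseteq> S'" "t \<in> fin_seqs \<kappa>" "reach S n t"
  shows "reach S' n t"
  using assms(2,3)
proof (induction n arbitrary: t)
  case 0
  then show ?case using assms(1) by auto
next
  case (Suc n)
  have "{\<nu> \<in> Field \<kappa>. reach S n (t @ [\<nu>])} \<inter> {\<nu> \<in> Field \<kappa>. t @ [\<nu>] \<in> fin_seqs \<kappa>} \<in> U t"
    using Suc.prems snoc_in_U UD(4) by simp
  then have "{\<nu> \<in> Field \<kappa>. reach S' n (t @ [\<nu>])} \<in> U t"
    by (rule UD(5)[OF Suc.prems(1)]) (use Suc.IH in auto)
  then show ?case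
    by simp
qed

text \<open>
  The strong Prikry property: otherwise countable completeness lets one thin out to a tree all of
  whose nodes are unreachable, and no extension of that condition has its stem in \<open>S\<close>.
\<close>

lemma ex_reach:
  assumes dense: "\<And>s T. (s, T) \<in> TP \<Longrightarrow> \<exists>t\<in>S. t \<in> T"
    and "s \<in> fin_seqs \<kappa>"
  shows "\<exists>n. reach S n s"
proof (rule ccontr)
  assume neg: "\<nexists>n. reach S n s"
  define T where "T = {t \<in> fin_seqs \<kappa>. prefix s t \<and> (\<forall>n. \<not> reach S n t)}"
  have "(s, T) \<in> TP"
  proof (rule TP_I)
    fix t assume t: "t \<in> T"
    then have tf: "t \<in> fin_seqs \<kappa>" and nr: "\<And>n. \<not> reach S n t"
      unfolding T_def by auto
    have "Field \<kappa> - {\<nu> \<in> Field \<kappa>. reach S n (t @ [\<nu>])} \<in> U t" for n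
      using nr[of "Suc n"] UD(6)[OF tf, of "{\<nu> \<in> Field \<kappa>. reach S n (t @ [\<nu>])}"] by auto
    then have "(\<Inter>n. Field \<kappa> - {\<nu> \<in> Field \<kappa>. reach S n (t @ [\<nu>])}) \<in> U t"
      by (intro complete_ultrafilter_INT[OF complete_U[OF tf]]
          countable_card_less[OF Card_order uncountable]) auto
    then have "(\<Inter>n. Field \<kappa> - {\<nu> \<in> Field \<kappa>. reach S n (t @ [\<nu>])}) \<inter>
        {\<nu> \<in> Field \<kappa>. t @ [\<nu>] \<in> fin_seqs \<kappa>} \<in> U t"
      using UD(4)[OF tf] snoc_in_U[OF tf] by blast
    then show "\<exists>X\<in>U t. \<forall>\<nu>\<in>X. t @ [\<nu>] \<in> T"
      by (rule bexI[rotated]) (use t in \<open>auto simp: T_def\<close>)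
  qed (use neg assms(2) in \<open>auto simp: T_def\<close>)
  then obtain t where "t \<in> S" "t \<in> T"
    using dense by blast
  then show False
    unfolding T_def by (auto dest: spec[of _ 0])
qed

end

section \<open>From a projection to ultrafilters\<close>

locale prikry_projection = forcing P le + ultra_tree \<kappa> U
  for P :: "'p set" and le and \<kappa> :: "'k rel" and U +
  fixes \<pi> :: "'k list \<times> 'k list set \<Rightarrow> 'p set"
  assumes card_P: "|P| =o \<kappa>" and distributive: "sigma_distributive P le"
    and proj: "projection TP tree_prikry_le (BP P le) BP_le \<pi>"
begin

lemma \<pi>_BP: "c \<in> TP \<Longrightarrow> \<pi> c \<in> BP P le"
  using proj unfolding projection_def by blast

lemma \<pi>_mono:
  assumes "(s, T) \<in> TP" "(s', T') \<in> TP" "s \<in> T'" "T \<subseteq> T'"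
  shows "\<pi> (s, T) \<subseteq> \<pi> (s', T')"
  using proj assms TP_le[OF assms(1,2)] unfolding projection_def BP_le_def by blast

section \<open>Conditions forced by a stem\<close>

text \<open>Inclusion in \<open>cone q\<close> says that the value of \<open>\<pi>\<close> is at
  least as strong as \<open>q\<close>. So these are the \<open>q\<close> that some condition with
  stem \<open>t\<close> forces into the generic filter induced by \<open>\<pi>\<close>.\<close>

definition forced :: "'k list \<Rightarrow> 'p set" where
  "forced t = {q \<in> P. \<exists>T. (t, T) \<in> TP \<and> \<pi> (t, T) \<subseteq> cone q}"

text \<open>A witnessing tree can be restricted to any of its nodes \<open>t @ [\<nu>]\<close>, and
  by monotonicity of \<open>\<pi>\<close> the restriction is still a witness.\<close>

lemma forced_snoc:
  assumes "q \<in> forced t"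
  shows "{\<nu> \<in> Field \<kappa>. q \<in> forced (t @ [\<nu>])} \<in> U t"
proof -
  obtain T where T: "q \<in> P" "(t, T) \<in> TP" "\<pi> (t, T) \<subseteq> cone q"
    using assms unfolding forced_def by blast
  note D = TP_D[OF T(2)]
  have "q \<in> forced (t @ [\<nu>])" if "t @ [\<nu>] \<in> T" for \<nu>
  proof -
    have "\<pi> (t @ [\<nu>], {u \<in> T. prefix (t @ [\<nu>]) u}) \<subseteq> \<pi> (t, T)"
      using that by (intro \<pi>_mono restrict_TP[OF T(2)] T(2)) auto
    then show ?thesis
      using T restrict_TP[OF T(2) that] unfolding forced_def by blast
  qed
  then show ?thesis
    using UD(5)[OF D(2) D(5)[OF D(1)], of "{\<nu> \<in> Field \<kappa>. q \<in> forced (t @ [\<nu>])}"] by blast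
qed

text \<open>Fewer than \<open>\<kappa>\<close> witnessing trees with stem \<open>t\<close> intersect
  to a condition; any point of its value under \<open>\<pi>\<close> bounds all of
  \<open>X\<close>.\<close>

lemma forced_directed:
  assumes "X \<subseteq> forced t" "|X| <o \<kappa>"
  shows "\<exists>r\<in>P. \<forall>q\<in>X. le q r"
proof (cases "X = {}")
  case True
  then show ?thesis using nonempty by blast
next
  case False
  have "\<forall>q\<in>X. \<exists>T. (t, T) \<in> TP \<and> \<pi> (t, T) \<subseteq> cone q"
    using assms(1) unfolding forced_def by blast
  then obtain T where T: "\<And>q. q \<in> X \<Longrightarrow> (t, T q) \<in> TP" "\<And>q. q \<in> X \<Longrightarrow> \<pi> (t, T q) \<subseteq> cone q"
    by metis
  have I: "(t, \<Inter>q\<in>X. T q) \<in> TP"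
    using INT_TP[OF False assms(2)] T(1) by blast
  obtain r where r: "r \<in> \<pi> (t, \<Inter>q\<in>X. T q)"
    using BP_nonempty[OF \<pi>_BP[OF I]] by blast
  have "r \<in> cone q" if "q \<in> X" for q
    using \<pi>_mono[OF I T(1)[OF that]] TP_D(1)[OF T(1)[OF that]] T(2)[OF that] r that by blast
  moreover have "r \<in> P"
    using r BP_subset[OF \<pi>_BP[OF I]] by blast
  ultimately show ?thesis
    unfolding cone_def by blast
qed

text \<open>Each node then has a successor that belongs to every large set of successors, so even
  the intersection of all trees with stem \<open>t\<close> is a condition, however many there are.
  It witnesses every \<open>q \<in> forced t\<close> at once.\<close>

lemma forced_bounded_if_all_principal:
  assumes "t \<in> fin_seqs \<kappa>" and principal: "\<And>\<eta>. \<eta> \<in> fin_seqs \<kappa> \<Longrightarrow> \<exists>\<nu>\<in>Field \<kappa>. {\<nu>} \<in> U \<eta>"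
  shows "\<exists>r\<in>P. \<forall>q\<in>forced t. le q r"
proof -
  define T where "T = \<Inter>{T. (t, T) \<in> TP}"
  have Tmin: "T \<subseteq> T'" if "(t, T') \<in> TP" for T'
    using that unfolding T_def by blast
  note full = full_tree_TP[OF assms(1)]
  have I: "(t, T) \<in> TP"
  proof (rule TP_I)
    show "t \<in> T"
      unfolding T_def using TP_D(1) by blast
    show sub: "T \<subseteq> fin_seqs \<kappa>"
      using Tmin[OF full] by blast
    show "prefix t u" if "u \<in> T" for u
      using Tmin[OF full] that by blast
    fix u assume u: "u \<in> T"
    then have uf: "u \<in> fin_seqs \<kappa>"
      using sub by blast
    then obtain \<nu> where \<nu>: "\<nu> \<in> Field \<kappa>" "{\<nu>} \<in> U u"
      using principal by blast
    have "u @ [\<nu>] \<in> T'" if T': "(t, T') \<in> TP" for T'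
    proof (rule ccontr)
      assume "u @ [\<nu>] \<notin> T'"
      then have "{\<nu> \<in> Field \<kappa>. u @ [\<nu>] \<in> T'} \<inter> {\<nu>} = {}"
        by auto
      moreover have "{\<nu> \<in> Field \<kappa>. u @ [\<nu>] \<in> T'} \<in> U u"
        using TP_D(5)[OF T'] u Tmin[OF T'] by blast
      ultimately show False
        using UD(3,4)[OF uf] \<nu>(2) by metis
    qed
    then have "u @ [\<nu>] \<in> T"
      unfolding T_def by blast
    then show "\<exists>X\<in>U u. \<forall>\<nu>\<in>X. u @ [\<nu>] \<in> T"
      using \<nu>(2) by blast
  qed
  obtain r where r: "r \<in> \<pi> (t, T)"
    using BP_nonempty[OF \<pi>_BP[OF I]] by blast
  have "le q r" if q: "q \<in> forced t" for q
  proof -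
    obtain T' where T': "(t, T') \<in> TP" "\<pi> (t, T') \<subseteq> cone q"
      using q unfolding forced_def by blast
    then have "r \<in> cone q"
      using \<pi>_mono[OF I T'(1) TP_D(1)[OF T'(1)] Tmin[OF T'(1)]] r by blast
    then show ?thesis
      unfolding cone_def by blast
  qed
  moreover have "r \<in> P"
    using r BP_subset[OF \<pi>_BP[OF I]] by blast
  ultimately show ?thesis
    by blast
qed

text \<open>A bound of \<open>forced t\<close> gives a principal ultrafilter. Otherwise directedness
  is combined with a uniform \<open>U \<eta>\<close>, where \<open>\<eta>\<close> may be unrelated
  to \<open>t\<close>.\<close>

lemma forced_ultrafilter:
  assumes "t \<in> fin_seqs \<kappa>"
  shows "\<exists>W. complete_ultrafilter \<kappa> P W \<and> (\<forall>q\<in>forced t. cone q \<in> W)"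
proof (cases "\<forall>\<eta>\<in>fin_seqs \<kappa>. \<exists>\<nu>\<in>Field \<kappa>. {\<nu>} \<in> U \<eta>")
  case True
  then obtain r where r: "r \<in> P" "\<forall>q\<in>forced t. le q r"
    using forced_bounded_if_all_principal[OF assms] by blast
  then have "\<forall>q\<in>forced t. cone q \<in> {X. X \<subseteq> P \<and> r \<in> X}"
    unfolding cone_def by blast
  then show ?thesis
    using complete_ultrafilter_principal[OF r(1)] by blast
next
  case False
  then obtain \<eta> where \<eta>: "\<eta> \<in> fin_seqs \<kappa>" "\<not> (\<exists>\<nu>\<in>Field \<kappa>. {\<nu>} \<in> U \<eta>)"
    by blast
  then have uniform: "\<forall>\<alpha>\<in>Field \<kappa>. aboveS \<kappa> \<alpha> \<in> U \<eta>"
    using complete_ultrafilter_uniform_or_principal[OF Card_order uncountable complete_U] by blast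
  have "|Field \<kappa>| =o |P|"
    using card_P card_of_Field_ordIso[OF Card_order] ordIso_symmetric ordIso_transitive by blast
  then obtain e where e: "bij_betw e (Field \<kappa>) P"
    using card_of_ordIso by blast
  \<comment> \<open>With \<open>P\<close> enumerated by \<open>e\<close>, the point
    \<open>r \<nu>\<close> bounds the members of \<open>forced t\<close> listed before
    \<open>\<nu>\<close>. Hence \<open>r \<nu>\<close> lies in \<open>cone (e \<alpha>)\<close> for
    all \<open>\<nu>\<close> beyond \<open>\<alpha>\<close>, a set in the uniform
    \<open>U \<eta>\<close>.\<close>
  have "\<exists>r\<in>P. \<forall>q\<in>forced t \<inter> e ` underS \<kappa> \<nu>. le q r" if "\<nu> \<in> Field \<kappa>" for \<nu>
  proof (rule forced_directed)
    have "|forced t \<inter> e ` underS \<kappa> \<nu>| \<le>o |underS \<kappa> \<nu>|"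
      using card_of_mono1[of "forced t \<inter> e ` underS \<kappa> \<nu>" "e ` underS \<kappa> \<nu>"] card_of_image ordLeq_transitive by blast
    then show "|forced t \<inter> e ` underS \<kappa> \<nu>| <o \<kappa>"
      using card_of_underS[OF Card_order that] ordLeq_ordLess_trans by blast
  qed auto
  then obtain r where r: "\<And>\<nu>. \<nu> \<in> Field \<kappa> \<Longrightarrow> r \<nu> \<in> P"
    "\<And>\<nu> q. \<nu> \<in> Field \<kappa> \<Longrightarrow> q \<in> forced t \<Longrightarrow> q \<in> e ` underS \<kappa> \<nu> \<Longrightarrow> le q (r \<nu>)"
    by (metis IntI)
  let ?W = "{X. X \<subseteq> P \<and> {\<nu> \<in> Field \<kappa>. r \<nu> \<in> X} \<in> U \<eta>}"
  have "cone q \<in> ?W" if q: "q \<in> forced t" for q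
  proof -
    have "q \<in> P"
      using q unfolding forced_def by blast
    then obtain \<alpha> where \<alpha>: "\<alpha> \<in> Field \<kappa>" "q = e \<alpha>"
      using e unfolding bij_betw_def by blast
    have "aboveS \<kappa> \<alpha> \<subseteq> {\<nu> \<in> Field \<kappa>. r \<nu> \<in> cone q}"
    proof
      fix \<nu> assume \<nu>: "\<nu> \<in> aboveS \<kappa> \<alpha>"
      then have "\<nu> \<in> Field \<kappa>" "\<alpha> \<in> underS \<kappa> \<nu>"
        unfolding aboveS_def underS_def Field_def by auto
      then show "\<nu> \<in> {\<nu> \<in> Field \<kappa>. r \<nu> \<in> cone q}"
        using r q \<alpha>(2) unfolding cone_def by blast
    qed
    then have "{\<nu> \<in> Field \<kappa>. r \<nu> \<in> cone q} \<in> U \<eta>"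
      using UD(5)[OF \<eta>(1)] uniform \<alpha>(1) by blast
    then show ?thesis
      unfolding cone_def by blast
  qed
  moreover have "complete_ultrafilter \<kappa> P ?W"
    using r(1) by (intro complete_ultrafilter_map complete_U \<eta>(1)) auto
  ultimately show ?thesis
    by blast
qed

section \<open>Ultrafilters containing all dense open sets\<close>

definition meets :: "'p set \<Rightarrow> 'k list set" where
  "meets D = {t. forced t \<inter> D \<noteq> {}}"

text \<open>One ultrafilter serves all \<open>D\<close> at once. For \<open>n = 0\<close>, an open
  \<open>D\<close> contains the cone of each of its points. At a successor, take the limit along
  \<open>U t\<close> of the ultrafilters at the extensions of \<open>t\<close>:
  \<open>forced_snoc\<close> carries the cones over, and the recursion of \<open>reach\<close> the
  sets \<open>D\<close>.\<close>

lemma reach_ultrafilter: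
  assumes "t \<in> fin_seqs \<kappa>"
  shows "\<exists>W. complete_ultrafilter \<kappa> P W \<and> (\<forall>q\<in>forced t. cone q \<in> W) \<and>
    (\<forall>D. open_in P le D \<and> reach (meets D) n t \<longrightarrow> D \<in> W)"
  using assms
proof (induction n arbitrary: t)
  case 0
  obtain W where W: "complete_ultrafilter \<kappa> P W" "\<forall>q\<in>forced t. cone q \<in> W"
    using forced_ultrafilter[OF 0] by blast
  have "D \<in> W" if D: "open_in P le D" "reach (meets D) 0 t" for D
  proof -
    obtain q where "q \<in> forced t" "q \<in> D"
      using D(2) unfolding meets_def by auto
    then have "cone q \<in> W" "cone q \<subseteq> D" "D \<subseteq> P"
      using W(2) D(1) unfolding open_in_def cone_def by auto
    then show ?thesis
      using complete_ultrafilterD(5)[OF W(1)] by blast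
  qed
  then show ?case
    using W by blast
next
  case (Suc n)
  let ?OK = "\<lambda>t W. complete_ultrafilter \<kappa> P W \<and> (\<forall>q\<in>forced t. cone q \<in> W) \<and>
    (\<forall>D. open_in P le D \<and> reach (meets D) n t \<longrightarrow> D \<in> W)"
  \<comment> \<open>The limit needs a complete ultrafilter at every \<open>\<nu>\<close>; where
    \<open>t @ [\<nu>]\<close> is not increasing, a principal one is the default.\<close>
  have "\<exists>W. complete_ultrafilter \<kappa> P W \<and> (t @ [\<nu>] \<in> fin_seqs \<kappa> \<longrightarrow> ?OK (t @ [\<nu>]) W)" for \<nu>
  proof (cases "t @ [\<nu>] \<in> fin_seqs \<kappa>")
    case True
    then show ?thesis
      using Suc.IH by blast
  next
    case False
    obtain m where "m \<in> P"
      using nonempty by blast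
    then have "complete_ultrafilter \<kappa> P {X. X \<subseteq> P \<and> m \<in> X}"
      by (rule complete_ultrafilter_principal)
    then show ?thesis
      using False by (intro exI conjI) auto
  qed
  then obtain W where W: "\<And>\<nu>. complete_ultrafilter \<kappa> P (W \<nu>)"
    "\<And>\<nu>. t @ [\<nu>] \<in> fin_seqs \<kappa> \<Longrightarrow> ?OK (t @ [\<nu>]) (W \<nu>)"
    by metis
  let ?W = "ultra_bind (Field \<kappa>) (U t) P W"
  have bind: "X \<in> ?W" if "X \<subseteq> P" "Y \<in> U t"
    "\<And>\<nu>. t @ [\<nu>] \<in> fin_seqs \<kappa> \<Longrightarrow> \<nu> \<in> Y \<Longrightarrow> X \<in> W \<nu>" for X Y
  proof -
    have "Y \<inter> {\<nu> \<in> Field \<kappa>. t @ [\<nu>] \<in> fin_seqs \<kappa>} \<in> U t"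
      using UD(4) snoc_in_U Suc.prems that(2) by blast
    then have "{\<nu> \<in> Field \<kappa>. X \<in> W \<nu>} \<in> U t"
      by (rule UD(5)[OF Suc.prems]) (use that(3) in auto)
    then show ?thesis
      using that(1) unfolding ultra_bind_def by blast
  qed
  have "complete_ultrafilter \<kappa> P ?W"
    using complete_ultrafilter_bind[OF complete_U[OF Suc.prems] W(1)] .
  moreover have "cone q \<in> ?W" if "q \<in> forced t" for q
    using W(2) by (intro bind[OF _ forced_snoc[OF that]]) (auto simp: cone_def)
  moreover have "D \<in> ?W" if D: "open_in P le D" "reach (meets D) (Suc n) t" for D
  proof (rule bind)
    show "D \<subseteq> P"
      using D(1) unfolding open_in_def by blast
    show "{\<nu> \<in> Field \<kappa>. reach (meets D) n (t @ [\<nu>])} \<in> U t"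
      using D(2) by simp
  qed (use W(2) D(1) in blast)
  ultimately show ?case
    by blast
qed

text \<open>Strengthen a point of \<open>\<pi> (s, T)\<close> to some \<open>q \<in> D\<close>. Then
  \<open>cone q\<close> lies inside \<open>\<pi> (s, T)\<close>, and the lifting property of
  \<open>\<pi>\<close> gives an extension of \<open>(s, T)\<close> whose stem is in \<open>T\<close>
  and forces \<open>q\<close>. Hence \<open>meets D\<close> intersects every tree, as
  \<open>ex_reach\<close> requires.\<close>

lemma reach_meets:
  assumes "dense_open_in P le D" "s \<in> fin_seqs \<kappa>"
  shows "\<exists>n. reach (meets D) n s"
proof (rule ex_reach[OF _ assms(2)])
  fix s T assume c: "(s, T) \<in> TP"
  obtain x where x: "x \<in> \<pi> (s, T)" "x \<in> P"
    using BP_nonempty[OF \<pi>_BP[OF c]] BP_subset[OF \<pi>_BP[OF c]] by blast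
  then obtain q where q: "q \<in> D" "le x q" "q \<in> P"
    using assms(1) unfolding dense_open_in_def dense_in_def by blast
  have "q \<in> \<pi> (s, T)"
    using BP_up[OF \<pi>_BP[OF c]] x q by blast
  then have "cone q \<subseteq> \<pi> (s, T)"
    using BP_up[OF \<pi>_BP[OF c]] unfolding cone_def by blast
  then obtain t T' where e: "(t, T') \<in> TP" "tree_prikry_le (s, T) (t, T')" "\<pi> (t, T') \<subseteq> cone q"
    using proj c cone_BP[OF q(3)] unfolding projection_def BP_le_def
    by (metis surj_pair)
  then have "t \<in> T" "q \<in> forced t"
    using TP_le[OF e(1) c] q(3) unfolding forced_def by blast+
  then show "\<exists>t\<in>meets D. t \<in> T"
    using q(1) unfolding meets_def by blast
qed

text \<open>
  If every \<open>n\<close> failed for some \<open>D n\<close>, then no number of steps would work for the intersection of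
  the \<open>D n\<close>, which is dense open by distributivity.
\<close>

lemma uniform_reach:
  assumes "s \<in> fin_seqs \<kappa>"
  shows "\<exists>n. \<forall>D. dense_open_in P le D \<longrightarrow> reach (meets D) n s"
proof (rule ccontr)
  assume "\<not> ?thesis"
  then obtain D where D: "\<And>n. dense_open_in P le (D n)" "\<And>n. \<not> reach (meets (D n)) n s"
    by metis
  let ?E = "P \<inter> \<Inter>(range D)"
  have "dense_open_in P le ?E"
    using distributive[unfolded sigma_distributive_def, rule_format, of "range D"] D(1) by auto
  then obtain n where "reach (meets ?E) n s"
    using reach_meets assms by blast
  moreover have "meets ?E \<subseteq> meets (D n)"
    unfolding meets_def by blast
  ultimately show False
    using reach_mono assms D(2) by blast
qed

text \<open>Density of the image of \<open>\<pi>\<close> yields a stem \<open>s\<close> with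
  \<open>p \<in> forced s\<close>. As a single \<open>n\<close> works for all dense open sets, the
  ultrafilter from \<open>reach_ultrafilter\<close> contains every generator.\<close>

lemma dense_filter_extension:
  assumes "p \<in> P"
  shows "\<exists>W. complete_ultrafilter \<kappa> P W \<and> dense_filter P le p \<subseteq> W"
proof -
  obtain s T where c: "(s, T) \<in> TP" "\<pi> (s, T) \<subseteq> cone p"
    using proj cone_BP[OF assms] unfolding projection_def dense_in_def BP_le_def by fastforce
  have s: "s \<in> fin_seqs \<kappa>" and p: "p \<in> forced s"
    using TP_D(2)[OF c(1)] c assms unfolding forced_def by auto
  obtain n where n: "\<And>D. dense_open_in P le D \<Longrightarrow> reach (meets D) n s"
    using uniform_reach[OF s] by blast
  obtain W where W: "complete_ultrafilter \<kappa> P W" "\<forall>q\<in>forced s. cone q \<in> W"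
    "\<forall>D. open_in P le D \<and> reach (meets D) n s \<longrightarrow> D \<in> W"
    using reach_ultrafilter[OF s] by blast
  note WD = complete_ultrafilterD[OF W(1)]
  have gen: "X \<in> W" if "X \<in> {D. dense_open_in P le D} \<union> {{q \<in> P. le p q}}" for X
    using that W(2,3) n p unfolding dense_open_in_def cone_def by blast
  have "P \<inter> \<Inter>G \<in> W" if "finite G" "G \<subseteq> W" for G
    using that
  proof (induction G)
    case empty
    then show ?case using WD(2) by simp
  next
    case (insert X G)
    then have "X \<inter> (P \<inter> \<Inter>G) \<in> W"
      using WD(4) by blast
    then show ?case
      by (simp add: Int_left_commute)
  qed
  then have "dense_filter P le p \<subseteq> W"
    using gen WD(5) unfolding dense_filter_def generated_filter_def by blast
  then show ?thesis
    using W(1) by blast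
qed

end

section \<open>From ultrafilters to a projection\<close>

text \<open>These assumptions isolate what the projection takes from (ii): almost all successors
  have labels in a given dense open set, and almost all have labels extending that of their
  predecessor.\<close>

locale labelled_tree = forcing P le + ultra_tree \<kappa> U
  for P :: "'p set" and le and \<kappa> :: "'k rel" and U +
  fixes h :: "'k list \<Rightarrow> 'p"
  assumes h_in: "\<And>t. t \<in> fin_seqs \<kappa> \<Longrightarrow> h t \<in> P"
    and h_onto: "\<And>p. p \<in> P \<Longrightarrow> \<exists>t\<in>fin_seqs \<kappa>. h t = p"
    and h_dense: "\<And>t D. t \<in> fin_seqs \<kappa> \<Longrightarrow> dense_open_in P le D \<Longrightarrow>
      {\<nu> \<in> Field \<kappa>. h (t @ [\<nu>]) \<in> D} \<in> U t"
    and h_up: "\<And>t. t \<in> fin_seqs \<kappa> \<Longrightarrow> {\<nu> \<in> Field \<kappa>. le (h t) (h (t @ [\<nu>]))} \<in> U t"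
begin

text \<open>
  The labels along a branch generate a generic filter; a condition can still put \<open>q\<close> into that
  filter iff some node of its tree has a label above \<open>q\<close>. The projection collects the \<open>q\<close> all of
  whose extensions are possible in this sense.
\<close>

definition possible :: "'k list \<times> 'k list set \<Rightarrow> 'p set" where
  "possible c = {q \<in> P. \<forall>r\<in>P. le q r \<longrightarrow> (\<exists>t\<in>snd c. le r (h t))}"

text \<open>If the set were empty, the conditions lying below no label of \<open>T\<close> would be
  dense open, so some successor of \<open>s\<close> in \<open>T\<close> would have such a condition
  as its label, which reflexivity forbids. Regularity holds because membership is itself a density
  requirement.\<close>

lemma possible_BP:
  assumes "(s, T) \<in> TP"
  shows "possible (s, T) \<in> BP P le"
proof -
  note D = TP_D[OF assms]
  have hP: "h t \<in> P" if "t \<in> T" for t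
    using that D(3) h_in by blast
  define E where "E = {q \<in> P. \<forall>t\<in>T. \<not> le q (h t)}"
  have "possible (s, T) \<noteq> {}"
  proof
    assume empty: "possible (s, T) = {}"
    have "\<exists>r\<in>E. le q r" if "q \<in> P" for q
      using empty that unfolding possible_def E_def by fastforce
    then have "dense_open_in P le E"
      using hP trans unfolding dense_open_in_def dense_in_def open_in_def E_def by blast
    then have "{\<nu> \<in> Field \<kappa>. h (s @ [\<nu>]) \<in> E} \<in> U s"
      using h_dense D(2) by blast
    then have "{\<nu> \<in> Field \<kappa>. h (s @ [\<nu>]) \<in> E} \<inter> {\<nu> \<in> Field \<kappa>. s @ [\<nu>] \<in> T} \<in> U s"
      using UD(4) D(1,2,5) by blast
    moreover have "{\<nu> \<in> Field \<kappa>. h (s @ [\<nu>]) \<in> E} \<inter> {\<nu> \<in> Field \<kappa>. s @ [\<nu>] \<in> T} = {}"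
      using refl unfolding E_def by blast
    ultimately show False
      using UD(3)[OF D(2)] by simp
  qed
  moreover have "q \<in> possible (s, T)"
    if q: "q \<in> P" "\<forall>r\<in>P. le q r \<longrightarrow> (\<exists>r'\<in>possible (s, T). le r r')" for q
  proof -
    have "\<exists>t\<in>T. le r (h t)" if r: "r \<in> P" "le q r" for r
    proof -
      obtain r' where r': "r' \<in> possible (s, T)" "le r r'"
        using q r by blast
      then obtain t where "r' \<in> P" "t \<in> T" "le r' (h t)"
        using refl unfolding possible_def by auto
      then show ?thesis
        using r r' trans hP by blast
    qed
    then show ?thesis
      using q(1) unfolding possible_def by simp
  qed
  moreover have "\<exists>r'\<in>possible (s, T). le r r'" if "q \<in> possible (s, T)" "r \<in> P" "le q r" for q r
  proof -
    have "r \<in> possible (s, T)"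
      using that trans unfolding possible_def by blast
    then show ?thesis
      using refl that(2) by blast
  qed
  moreover have "possible (s, T) \<subseteq> P"
    unfolding possible_def by blast
  ultimately show ?thesis
    unfolding BP_iff' by blast
qed

text \<open>Keep only the nodes whose labels extend \<open>h t\<close>; by \<open>h_up\<close> this
  is still a condition. Every extension of a point that remains possible is compatible with
  \<open>h t\<close>, so separativity puts that point in \<open>cone (h t)\<close>.\<close>

lemma possible_below:
  assumes "(s, T) \<in> TP" "t \<in> T"
  shows "\<exists>T'. (t, T') \<in> TP \<and> T' \<subseteq> T \<and> possible (t, T') \<subseteq> cone (h t)"
proof (intro exI conjI)
  note D = TP_D[OF assms(1)]
  let ?T = "{u \<in> T. prefix t u \<and> le (h t) (h u)}"
  have tf: "t \<in> fin_seqs \<kappa>"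
    using D(3) assms(2) by blast
  show "(t, ?T) \<in> TP"
  proof (rule TP_I)
    fix u assume u: "u \<in> ?T"
    then have uf: "u \<in> fin_seqs \<kappa>"
      using D(3) by blast
    let ?X = "{\<nu> \<in> Field \<kappa>. u @ [\<nu>] \<in> T} \<inter> {\<nu> \<in> Field \<kappa>. le (h u) (h (u @ [\<nu>]))}"
    have "?X \<in> U u"
      using UD(4)[OF uf] D(5) u h_up[OF uf] by blast
    moreover have "u @ [\<nu>] \<in> ?T" if "\<nu> \<in> ?X" for \<nu>
    proof -
      have "u @ [\<nu>] \<in> fin_seqs \<kappa>"
        using that D(3) by blast
      then have "le (h t) (h (u @ [\<nu>]))"
        using trans[of "h t" "h u" "h (u @ [\<nu>])"] that u h_in uf tf by blast
      then show ?thesis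
        using that u by auto
    qed
    ultimately show "\<exists>X\<in>U u. \<forall>\<nu>\<in>X. u @ [\<nu>] \<in> ?T"
      by blast
  qed (use assms tf D(3) h_in refl in auto)
  show "possible (t, ?T) \<subseteq> cone (h t)"
  proof
    fix x assume x: "x \<in> possible (t, ?T)"
    then have xP: "x \<in> P"
      unfolding possible_def by blast
    have "le (h t) x"
    proof (rule separative[OF h_in[OF tf] xP])
      fix r assume "r \<in> P" "le x r"
      then obtain u where "u \<in> ?T" "le r (h u)"
        using x unfolding possible_def by auto
      then show "compat_in P le (h t) r"
        using D(3) h_in unfolding compat_in_def by blast
    qed
    then show "x \<in> cone (h t)"
      using xP unfolding cone_def by blast
  qed
qed blast

text \<open>For density and lifting alike, find a node whose label lies in the given regular open
  set and shrink the tree there by \<open>possible_below\<close>. For density \<open>h_onto\<close>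
  supplies the node; for lifting, a point of \<open>b\<close> is possible and so lies below the
  label of a node of \<open>T\<close>.\<close>

lemma projection_possible: "projection TP tree_prikry_le (BP P le) BP_le possible"
  unfolding projection_def
proof (intro conjI ballI impI)
  show "possible \<in> TP \<rightarrow> BP P le"
    using possible_BP by auto
next
  fix c c' assume "c \<in> TP" "c' \<in> TP" "tree_prikry_le c c'"
  then have "snd c' \<subseteq> snd c"
    by (metis TP_le prod.collapse)
  then show "BP_le (possible c) (possible c')"
    unfolding BP_le_def possible_def by blast
next
  show "dense_in (BP P le) BP_le (possible ` TP)"
    unfolding dense_in_def
  proof (intro conjI ballI)
    show "possible ` TP \<subseteq> BP P le"
      using possible_BP by auto
    fix b assume b: "b \<in> BP P le"
    then obtain q where q: "q \<in> b" "q \<in> P"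
      using BP_nonempty BP_subset by blast
    then obtain t where t: "t \<in> fin_seqs \<kappa>" "h t = q"
      using h_onto by blast
    have "t \<in> {u \<in> fin_seqs \<kappa>. prefix t u}"
      using t by simp
    then obtain T where "(t, T) \<in> TP" "possible (t, T) \<subseteq> cone q"
      using possible_below[OF full_tree_TP[OF t(1)]] t(2) by blast
    moreover have "cone q \<subseteq> b"
      using BP_up[OF b q(1)] unfolding cone_def by blast
    ultimately show "\<exists>d\<in>possible ` TP. BP_le b d"
      unfolding BP_le_def by blast
  qed
next
  fix c b assume c: "c \<in> TP" and b: "b \<in> BP P le" "BP_le (possible c) b"
  obtain s T where sT: "c = (s, T)"
    by fastforce
  obtain q where q: "q \<in> b" "q \<in> P"
    using b(1) BP_nonempty BP_subset by blast
  then have "q \<in> possible (s, T)"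
    using b(2) sT unfolding BP_le_def by blast
  then obtain t where t: "t \<in> T" "le q (h t)"
    using q(2) refl unfolding possible_def by auto
  have cT: "(s, T) \<in> TP"
    using c sT by simp
  have "h t \<in> P"
    using TP_D(3)[OF cT] t(1) h_in by blast
  then have "h t \<in> b"
    using BP_up[OF b(1) q(1)] t(2) by blast
  then have "cone (h t) \<subseteq> b"
    using BP_up[OF b(1)] unfolding cone_def by blast
  moreover obtain T' where T': "(t, T') \<in> TP" "T' \<subseteq> T" "possible (t, T') \<subseteq> cone (h t)"
    using possible_below[OF cT t(1)] by blast
  ultimately have "tree_prikry_le c (t, T')" "BP_le b (possible (t, T'))"
    using TP_le[OF T'(1) cT] t(1) sT unfolding BP_le_def by blast+
  then show "\<exists>c'\<in>TP. tree_prikry_le c c' \<and> BP_le b (possible c')"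
    using T'(1) by blast
qed

end

section \<open>Constructing the labelled tree\<close>

lemma labelled_tree_exists:
  assumes \<kappa>: "Card_order \<kappa>" "uncountable (Field \<kappa>)" and P: "forcing_notion P le" "|P| =o \<kappa>"
    and W: "\<And>p. p \<in> P \<Longrightarrow> complete_ultrafilter \<kappa> P (W p)"
      "\<And>p. p \<in> P \<Longrightarrow> dense_filter P le p \<subseteq> W p"
  shows "\<exists>U h. labelled_tree P le \<kappa> U h"
proof -
  interpret forcing P le
    using P(1) by unfold_locales
  obtain f where f: "f \<in> Field \<kappa> \<rightarrow> P"
    "\<And>\<alpha> p. \<alpha> \<in> Field \<kappa> \<Longrightarrow> p \<in> P \<Longrightarrow> \<exists>\<nu>\<in>aboveS \<kappa> \<alpha>. f \<nu> = p"
    using unbounded_fibres[OF \<kappa> P(2)] by blast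
  have above_Field: "aboveS \<kappa> \<alpha> \<subseteq> Field \<kappa>" for \<alpha>
    unfolding aboveS_def Field_def by blast
  obtain m where m: "m \<in> P"
    using nonempty by blast
  \<comment> \<open>A nonempty sequence is labelled through its last entry. The empty one has none,
    so \<open>m\<close> and, in \<open>base\<close>, \<open>\<alpha>0\<close> are arbitrary
    defaults.\<close>
  define h where "h = (\<lambda>t. if t = [] then m else f (last t))"
  obtain \<alpha>0 where \<alpha>0: "\<alpha>0 \<in> Field \<kappa>"
    using \<kappa>(2) by (metis countable_empty ex_in_conv)
  define base where "base = (\<lambda>t. if t = [] then \<alpha>0 else last t)"
  have last_Field: "last t \<in> Field \<kappa>" if "t \<in> fin_seqs \<kappa>" "t \<noteq> []" for t
    using that last_in_set unfolding fin_seqs_def by blast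
  have base: "base t \<in> Field \<kappa>" if "t \<in> fin_seqs \<kappa>" for t
    using last_Field[OF that] \<alpha>0 unfolding base_def by simp
  have hP: "h t \<in> P" if "t \<in> fin_seqs \<kappa>" for t
    using last_Field[OF that] f(1) m unfolding h_def by auto
  have "\<exists>g. \<forall>p\<in>P. g p \<in> aboveS \<kappa> \<alpha> \<and> f (g p) = p" if "\<alpha> \<in> Field \<kappa>" for \<alpha>
    using f(2)[OF that] by metis
  then obtain g where g: "\<And>\<alpha> p. \<alpha> \<in> Field \<kappa> \<Longrightarrow> p \<in> P \<Longrightarrow> g \<alpha> p \<in> aboveS \<kappa> \<alpha>"
    "\<And>\<alpha> p. \<alpha> \<in> Field \<kappa> \<Longrightarrow> p \<in> P \<Longrightarrow> f (g \<alpha> p) = p"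
    by metis
  \<comment> \<open>The section \<open>g (base t)\<close> of \<open>f\<close> copies
    \<open>W (h t)\<close> above \<open>base t\<close>. Since \<open>f\<close> undoes
    \<open>g\<close>, the \<open>f\<close>-preimage of each member of \<open>W (h t)\<close> belongs
    to \<open>U t\<close>.\<close>
  define U where "U = (\<lambda>t. {X. X \<subseteq> Field \<kappa> \<and> {p \<in> P. g (base t) p \<in> X} \<in> W (h t)})"
  have cU: "complete_ultrafilter \<kappa> (Field \<kappa>) (U t)" if "t \<in> fin_seqs \<kappa>" for t
    unfolding U_def using above_Field g(1)[OF base[OF that]]
    by (intro complete_ultrafilter_map W(1) hP that) blast
  have lift: "{\<nu> \<in> Field \<kappa>. f \<nu> \<in> X} \<in> U t" if t: "t \<in> fin_seqs \<kappa>" and X: "X \<in> W (h t)" for t X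
  proof -
    have "X \<subseteq> P"
      using complete_ultrafilterD(1)[OF W(1)[OF hP[OF t]] X] .
    then have "{p \<in> P. g (base t) p \<in> {\<nu> \<in> Field \<kappa>. f \<nu> \<in> X}} = X"
      using g[OF base[OF t]] above_Field[of "base t"] by auto
    then show ?thesis
      using X unfolding U_def by simp
  qed
  have gen: "X \<in> W p" if "p \<in> P" "X \<in> {D. dense_open_in P le D} \<union> {{q \<in> P. le p q}}" for X p
  proof -
    have "X \<subseteq> P"
      using that(2) unfolding dense_open_in_def dense_in_def by blast
    then have "X \<in> dense_filter P le p"
      using that(2) unfolding dense_filter_def generated_filter_def
      by (auto intro!: exI[of _ "{X}"])
    then show ?thesis
      using W(2)[OF that(1)] by blast
  qed
  have "aboveS \<kappa> (last t) \<in> U t" if t: "t \<in> fin_seqs \<kappa>" "t \<noteq> []" for t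
  proof -
    have "{p \<in> P. g (base t) p \<in> aboveS \<kappa> (last t)} = P"
      using g(1)[OF base[OF t(1)]] t(2) unfolding base_def by auto
    then show ?thesis
      using complete_ultrafilterD(2)[OF W(1)[OF hP[OF t(1)]]] above_Field unfolding U_def by simp
  qed
  then have tree: "ultrafilter_tree \<kappa> U"
    using cU unfolding ultrafilter_tree_def complete_ultrafilter_def by blast
  have "labelled_tree P le \<kappa> U h"
  proof unfold_locales
    fix p assume p: "p \<in> P"
    obtain \<nu> where \<nu>: "\<nu> \<in> aboveS \<kappa> \<alpha>0" "f \<nu> = p"
      using f(2)[OF \<alpha>0 p] by blast
    then have "[\<nu>] \<in> fin_seqs \<kappa>" "h [\<nu>] = p"
      using above_Field unfolding fin_seqs_def h_def by auto
    then show "\<exists>t\<in>fin_seqs \<kappa>. h t = p"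
      by blast
  next
    fix t D assume t: "t \<in> fin_seqs \<kappa>" and "dense_open_in P le D"
    then have "D \<in> W (h t)"
      using gen[OF hP[OF t]] by blast
    from lift[OF t this] show "{\<nu> \<in> Field \<kappa>. h (t @ [\<nu>]) \<in> D} \<in> U t"
      unfolding h_def by simp
  next
    fix t assume t: "t \<in> fin_seqs \<kappa>"
    have "{q \<in> P. le (h t) q} \<in> W (h t)"
      using gen[OF hP[OF t]] by blast
    from lift[OF t this] have "{\<nu> \<in> Field \<kappa>. f \<nu> \<in> {q \<in> P. le (h t) q}} \<in> U t" .
    moreover have "{\<nu> \<in> Field \<kappa>. f \<nu> \<in> {q \<in> P. le (h t) q}} =
        {\<nu> \<in> Field \<kappa>. le (h t) (h (t @ [\<nu>]))}"
      using f(1) unfolding h_def by auto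
    ultimately show "{\<nu> \<in> Field \<kappa>. le (h t) (h (t @ [\<nu>]))} \<in> U t"
      by simp
  qed (use \<kappa> tree cU hP in \<open>auto simp: complete_ultrafilter_def\<close>)
  then show ?thesis
    by blast
qed

theorem theorem3p2:
  fixes \<kappa> :: "'k rel" and P :: "'p set" and le :: "'p \<Rightarrow> 'p \<Rightarrow> bool"
  assumes "Card_order \<kappa>" and "uncountable (Field \<kappa>)"
    and "forcing_notion P le" and "sigma_distributive P le" and "|P| =o \<kappa>"
  shows "(\<exists>U \<pi>. ultrafilter_tree \<kappa> U \<and> (\<forall>\<eta>\<in>fin_seqs \<kappa>. kappa_complete \<kappa> (U \<eta>)) \<and>
            projection (tree_prikry \<kappa> U) tree_prikry_le (BP P le) BP_le \<pi>)
         \<longleftrightarrow>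
         (\<forall>p\<in>P. \<exists>W. ultrafilter_on P W \<and> kappa_complete \<kappa> W \<and> dense_filter P le p \<subseteq> W)"
    (is "?L \<longleftrightarrow> ?R")
proof
  assume ?L
  then obtain U \<pi> where U: "ultrafilter_tree \<kappa> U" "\<forall>\<eta>\<in>fin_seqs \<kappa>. kappa_complete \<kappa> (U \<eta>)"
    "projection (tree_prikry \<kappa> U) tree_prikry_le (BP P le) BP_le \<pi>"
    by blast
  interpret prikry_projection P le \<kappa> U \<pi>
    using assms U by unfold_locales auto
  show ?R
    using dense_filter_extension unfolding complete_ultrafilter_def by blast
next
  assume ?R
  then obtain W where "\<And>p. p \<in> P \<Longrightarrow> complete_ultrafilter \<kappa> P (W p)"
      "\<And>p. p \<in> P \<Longrightarrow> dense_filter P le p \<subseteq> W p"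
    unfolding complete_ultrafilter_def by metis
  then obtain U h where "labelled_tree P le \<kappa> U h"
    using labelled_tree_exists[OF assms(1,2,3,5)] by blast
  then interpret labelled_tree P le \<kappa> U h .
  show ?L
    using tree complete projection_possible by blast
qed

end
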